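(* For every even integer $n \geq 4$, $\dim_E(CC_n) = \frac{3n}{2}$.
   Context: For a connected graph $G$, $d_G(u,v)$ is the number of edges in a shortest path between vertices $u$ and $v$. For a vertex $u$ and an edge $e = vw$, the distance is $d_G(e,u) = \min\{d_G(v,u), d_G(w,u)\}$. A set $S \subseteq V(G)$ is an edge resolving set of $G$ if for every pair of distinct edges $e,f \in E(G)$ there is $w \in S$ with $d_G(w,e) \neq d_G(w,f)$. The edge metric dimension $\dim_E(G)$ is the minimum cardinality of an edge resolving set of $G$. For $n \geq 3$, the cyclic silicate $CC_n$ is the simple graph obtained from a cycle of length $n$ by replacing each edge with a tetrahedron: for each edge $uv$ of the cycle, two new vertices are added (different new vertices for different edges of the cycle), and these two new vertices together with $u$ and $v$ are made pairwise adjacent, forming a $K_4$ that contains the edge $uv$. It has $3n$ vertices and $6n$ edges. *)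

theory Defs
  imports Main
begin

record 'a ugraph =
  uverts :: "'a set"
  uedges :: "'a set set"

definition simple_graph :: "'a ugraph \<Rightarrow> bool" where
  "simple_graph G \<longleftrightarrow> (\<forall>e \<in> uedges G. e \<subseteq> uverts G \<and> card e = 2)"

text \<open>A path is represented by its nonempty list of distinct vertices, so it has
  \<open>length p - 1\<close> edges.\<close>

definition is_path :: "'a ugraph \<Rightarrow> 'a \<Rightarrow> 'a list \<Rightarrow> 'a \<Rightarrow> bool" where
  "is_path G u p v \<longleftrightarrow>
     p \<noteq> [] \<and> hd p = u \<and> last p = v \<and> distinct p \<and> set p \<subseteq> uverts G \<and>
     (\<forall>i. Suc i < length p \<longrightarrow> {p ! i, p ! Suc i} \<in> uedges G)"

text \<open>The distance is meaningful only if some path joins the two vertices; otherwise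
  the \<open>LEAST\<close> is an unspecified number.\<close>

definition vdist :: "'a ugraph \<Rightarrow> 'a \<Rightarrow> 'a \<Rightarrow> nat" where
  "vdist G u v = (LEAST k. \<exists>p. is_path G u p v \<and> length p = Suc k)"

definition edist :: "'a ugraph \<Rightarrow> 'a set \<Rightarrow> 'a \<Rightarrow> nat" where
  "edist G e u = Min ((\<lambda>v. vdist G v u) ` e)"

definition edge_resolving :: "'a ugraph \<Rightarrow> 'a set \<Rightarrow> bool" where
  "edge_resolving G S \<longleftrightarrow>
     S \<subseteq> uverts G \<and>
     (\<forall>e \<in> uedges G. \<forall>f \<in> uedges G. e \<noteq> f \<longrightarrow> (\<exists>w \<in> S. edist G e w \<noteq> edist G f w))"

text \<open>Finiteness of \<open>S\<close> is required because \<open>card\<close> of an infinite set is 0. In a finite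
  connected simple graph the whole vertex set is edge resolving, so the minimum exists.\<close>

definition edge_metric_dim :: "'a ugraph \<Rightarrow> nat" where
  "edge_metric_dim G = (LEAST k. \<exists>S. edge_resolving G S \<and> finite S \<and> card S = k)"

text \<open>A simple cycle only for \<open>n \<ge> 3\<close>.\<close>

definition cycle_graph :: "nat \<Rightarrow> nat ugraph" where
  "cycle_graph n = \<lparr>uverts = {..<n}, uedges = {{i, Suc i mod n} | i. i < n}\<rparr>"

text \<open>Every edge \<open>e\<close> of the base graph receives the two new vertices \<open>Apex e False\<close> and
  \<open>Apex e True\<close>; together with the ends of \<open>e\<close> they span a complete graph on four
  vertices, which contains the original edge \<open>e\<close>.\<close>

datatype 'a silicate_vertex = Base 'a | Apex "'a set" bool

definition tetrahedron :: "'a set \<Rightarrow> 'a silicate_vertex set" where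
  "tetrahedron e = Base ` e \<union> {Apex e False, Apex e True}"

definition silicate :: "'a ugraph \<Rightarrow> 'a silicate_vertex ugraph" where
  "silicate G =
     \<lparr>uverts = Base ` uverts G \<union> {Apex e b | e b. e \<in> uedges G},
      uedges = {{x, y} | x y e. e \<in> uedges G \<and> x \<in> tetrahedron e \<and> y \<in> tetrahedron e \<and> x \<noteq> y}\<rparr>"

definition cyclic_silicate :: "nat \<Rightarrow> nat silicate_vertex ugraph" where
  "cyclic_silicate n = silicate (cycle_graph n)"

lemma inj_on_cycle_edge:
  assumes "n \<ge> 3"
  shows "inj_on (\<lambda>i. {i, Suc i mod n}) {..<n}"
proof (rule inj_onI)
  fix i j assume ij: "i \<in> {..<n}" "j \<in> {..<n}" "{i, Suc i mod n} = {j, Suc j mod n}"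
  show "i = j"
  proof (rule ccontr)
    assume "i \<noteq> j"
    then have "i = Suc j mod n" "j = Suc i mod n" using ij(3) by (auto simp: doubleton_eq_iff)
    moreover have "Suc k mod n = (if Suc k = n then 0 else Suc k)" if "k < n" for k
      using that by simp
    moreover have "i < n" "j < n" using ij(1,2) by auto
    ultimately have "i = 0 \<and> Suc j = n \<or> i = Suc j" "j = 0 \<and> Suc i = n \<or> j = Suc i"
      by metis+
    then show False using assms by linarith
  qed
qed

lemma simple_graph_cycle:
  assumes "n \<ge> 3"
  shows "simple_graph (cycle_graph n)"
proof -
  have "{i, Suc i mod n} \<subseteq> {..<n} \<and> card {i, Suc i mod n} = 2" if "i < n" for i
  proof -
    have "i \<noteq> Suc i mod n" using assms that by (cases "Suc i = n") auto
    then show ?thesis using that by simp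
  qed
  then show ?thesis by (auto simp: simple_graph_def cycle_graph_def)
qed

lemma simple_graph_cyclic_silicate:
  assumes "n \<ge> 3"
  shows "simple_graph (cyclic_silicate n)"
proof -
  have "tetrahedron e \<subseteq> uverts (cyclic_silicate n)" if "e \<in> uedges (cycle_graph n)" for e
  proof -
    have "e \<subseteq> uverts (cycle_graph n)"
      using simple_graph_cycle[OF assms] that by (simp add: simple_graph_def)
    then show ?thesis using that
      by (auto simp: tetrahedron_def cyclic_silicate_def silicate_def)
  qed
  then have "\<forall>e \<in> uedges (cyclic_silicate n). e \<subseteq> uverts (cyclic_silicate n)"
    by (auto simp: cyclic_silicate_def silicate_def)
  moreover have "\<forall>e \<in> uedges (cyclic_silicate n). card e = 2"
    by (auto simp: cyclic_silicate_def silicate_def)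
  ultimately show ?thesis by (simp add: simple_graph_def)
qed

lemma card_cycle_edges:
  assumes "n \<ge> 3"
  shows "card (uedges (cycle_graph n)) = n" and "finite (uedges (cycle_graph n))"
proof -
  have *: "uedges (cycle_graph n) = (\<lambda>i. {i, Suc i mod n}) ` {..<n}"
    by (auto simp: cycle_graph_def)
  show "card (uedges (cycle_graph n)) = n"
    unfolding * using card_image[OF inj_on_cycle_edge[OF assms]] by simp
  show "finite (uedges (cycle_graph n))" unfolding * by simp
qed

lemma card_verts_cyclic_silicate:
  assumes "n \<ge> 3"
  shows "card (uverts (cyclic_silicate n)) = 3 * n"
proof -
  let ?E = "uedges (cycle_graph n)"
  have A: "{Apex e b | e b. e \<in> ?E} = (\<lambda>(e, b). Apex e b) ` (?E \<times> UNIV)" by auto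
  have "card {Apex e b | e b. e \<in> ?E} = 2 * n"
    unfolding A
    by (subst card_image)
      (auto simp: inj_on_def card_cartesian_product card_cycle_edges[OF assms])
  moreover have "finite {Apex e b | e b. e \<in> ?E}"
    unfolding A using card_cycle_edges(2)[OF assms] by simp
  moreover have "card (Base ` {..<n}) = n" by (simp add: card_image inj_on_def)
  moreover have "uverts (cyclic_silicate n) = Base ` {..<n} \<union> {Apex e b | e b. e \<in> ?E}"
    by (simp add: cyclic_silicate_def silicate_def cycle_graph_def)
  moreover have "Base ` {..<n} \<inter> {Apex e b | e b. e \<in> ?E} = {}" by auto
  ultimately show ?thesis by (simp add: card_Un_disjoint)
qed

lemma card_edges_cyclic_silicate:
  assumes n: "n \<ge> 3"
  shows "card (uedges (cyclic_silicate n)) = 6 * n"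
proof -
  let ?E = "uedges (cycle_graph n)"
  let ?K = "\<lambda>e. {{x, y} | x y. x \<in> tetrahedron e \<and> y \<in> tetrahedron e \<and> x \<noteq> y}"
  have two: "card e = 2" if "e \<in> ?E" for e
    using simple_graph_cycle[OF n] that by (auto simp: simple_graph_def)
  have T: "finite (tetrahedron e) \<and> card (tetrahedron e) = 4" if "e \<in> ?E" for e
  proof -
    obtain a b where "e = {a, b}" "a \<noteq> b" using two[of e] \<open>e \<in> ?E\<close> unfolding card_2_iff by blast
    then show ?thesis by (simp add: tetrahedron_def)
  qed
  have K: "?K e = {s. s \<subseteq> tetrahedron e \<and> card s = 2}" for e
  proof (intro equalityI subsetI)
    fix s assume "s \<in> ?K e"
    then obtain x y where "s = {x, y}" "x \<in> tetrahedron e" "y \<in> tetrahedron e" "x \<noteq> y" by blast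
    then show "s \<in> {s. s \<subseteq> tetrahedron e \<and> card s = 2}" by simp
  next
    fix s assume s: "s \<in> {s. s \<subseteq> tetrahedron e \<and> card s = 2}"
    then obtain x y where "s = {x, y}" "x \<noteq> y" unfolding card_2_iff by blast
    then show "s \<in> ?K e" using s by blast
  qed
  have cK: "card (?K e) = 6" if "e \<in> ?E" for e
  proof -
    have "card (?K e) = 4 choose 2"
      unfolding K using n_subsets[of "tetrahedron e" 2] T[OF that] by (simp only: conjunct1 conjunct2)
    then show ?thesis by (simp add: choose_two)
  qed
  have fK: "finite (?K e)" if "e \<in> ?E" for e
    by (rule card_ge_0_finite) (simp only: cK[OF that])
  have base: "s = Base ` e"
    if "s \<in> ?K e" "s \<in> ?K f" "e \<in> ?E" "e \<noteq> f" for s e f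
  proof (rule card_subset_eq)
    have s: "s \<subseteq> tetrahedron e" "s \<subseteq> tetrahedron f" "card s = 2"
      using that(1,2) unfolding K by simp_all
    show "finite (Base ` e)" using two[OF that(3)] by (intro finite_imageI card_ge_0_finite) simp
    show "s \<subseteq> Base ` e" using s(1,2) \<open>e \<noteq> f\<close> by (auto simp: tetrahedron_def)
    show "card s = card (Base ` e)"
      using two[OF that(3)] s(3) by (simp add: card_image inj_on_def)
  qed
  have disj: "?K e \<inter> ?K f = {}" if "e \<in> ?E" "f \<in> ?E" "e \<noteq> f" for e f
  proof (rule ccontr)
    assume "?K e \<inter> ?K f \<noteq> {}"
    then obtain s where "s \<in> ?K e \<inter> ?K f" by (meson ex_in_conv)
    then have s: "s \<in> ?K e" "s \<in> ?K f" by (rule IntD1, rule IntD2)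
    have "Base ` e = Base ` f"
      using base[OF s that(1,3)] base[OF s(2,1) that(2) that(3)[symmetric]] by (rule subst)
    then have "e = f" by (simp add: inj_image_eq_iff inj_on_def)
    with that(3) show False ..
  qed
  have "uedges (cyclic_silicate n) = (\<Union>e \<in> ?E. ?K e)"
    unfolding cyclic_silicate_def silicate_def ugraph.simps by blast
  then have "card (uedges (cyclic_silicate n)) = card (\<Union>e \<in> ?E. ?K e)" by (rule arg_cong)
  also have "\<dots> = (\<Sum>e \<in> ?E. card (?K e))"
    by (rule card_UN_disjoint) (use card_cycle_edges(2)[OF n] fK disj in blast)+
  also have "\<dots> = (\<Sum>e \<in> ?E. 6)" by (rule sum.cong[OF refl cK])
  also have "\<dots> = 6 * n" by (simp add: card_cycle_edges[OF n])
  finally show ?thesis .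
qed

end

theory Submission
  imports Defs
begin

text \<open>
  Write \<open>v\<close> for a base vertex, and call the two new vertices of a tetrahedron its apices.

  Lower bound. Every neighbour of an apex \<open>x\<close> lies in the tetrahedron of \<open>x\<close>, hence is equal or
  adjacent to each base vertex \<open>v\<close> of that tetrahedron. So \<open>x\<close> is useless as a shortcut: a path
  from \<open>x\<close> to a vertex \<open>w \<noteq> x\<close> can be rerouted to start at \<open>v\<close> without becoming longer, and the
  distance from the edge \<open>vx\<close> to \<open>w\<close> is simply the distance from \<open>v\<close> to \<open>w\<close>. If \<open>x\<close> and \<open>y\<close> are two
  apices adjacent to \<open>v\<close>, the edges \<open>vx\<close> and \<open>vy\<close> can therefore be separated only by \<open>x\<close> or \<open>y\<close>
  (\<open>apex_in_edge_resolving\<close>). Four apices are adjacent to each vertex of the cycle, and an edge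
  resolving set misses at most one of them. For \<open>n\<close> even, the quadruples around every other
  vertex of the cycle partition the \<open>2n\<close> apices into \<open>n/2\<close> groups, each contributing at least 3.

  Upper bound. Take all but one apex of each such quadruple: one apex of every tetrahedron, and
  the second one of every other tetrahedron. No long distances are needed to see that this set
  resolves. Whether an edge has distance 0 from an apex tells whether it contains
  that apex, and whether it has distance at most 1 tells whether it meets the tetrahedron of that
  apex; these data already determine the edge (\<open>edge_determined_by_tetrahedra\<close>).
\<close>

section \<open>Distances in connected graphs\<close>

text \<open>Connectedness is phrased by reachability, where walks may repeat vertices and concatenate
  freely; \<open>path_of_rtrancl\<close> recovers the paths with distinct vertices that define distances.\<close>

definition connected_graph :: "'a ugraph \<Rightarrow> bool" where
  "connected_graph G \<longleftrightarrow>
     (\<forall>u \<in> uverts G. \<forall>v \<in> uverts G. (u, v) \<in> {(x, y). {x, y} \<in> uedges G}\<^sup>*)"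

lemma is_path_take:
  assumes "is_path G u p v" "i < length p"
  shows "is_path G u (take (Suc i) p) (p ! i)"
proof -
  have "last (take (Suc i) p) = p ! i" using assms(2) by (simp add: take_Suc_conv_app_nth)
  then show ?thesis using assms set_take_subset[of "Suc i" p] by (auto simp: is_path_def)
qed

lemma is_path_drop:
  assumes "is_path G u p v" "i < length p"
  shows "is_path G (p ! i) (drop i p) v"
  using assms set_drop_subset[of i p] by (auto simp: is_path_def hd_drop_conv_nth)

lemma is_path_snoc:
  assumes "is_path G u p v" "{v, w} \<in> uedges G" "w \<in> uverts G" "w \<notin> set p"
  shows "is_path G u (p @ [w]) w"
  unfolding is_path_def
proof (intro conjI allI impI)
  fix i assume i: "Suc i < length (p @ [w])"
  show "{(p @ [w]) ! i, (p @ [w]) ! Suc i} \<in> uedges G"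
  proof (cases "Suc i < length p")
    case True
    then show ?thesis using assms(1) by (auto simp: is_path_def nth_append)
  next
    case False
    then have "Suc i = length p" using i by simp
    then have "p ! i = v" using assms(1) by (metis is_path_def last_conv_nth diff_Suc_1)
    then show ?thesis using assms(2) \<open>Suc i = length p\<close> by (simp add: nth_append)
  qed
qed (use assms in \<open>auto simp: is_path_def\<close>)

lemma is_path_change_head:
  assumes "is_path G x (x # z # p) w" "{v, z} \<in> uedges G" "v \<in> uverts G" "v \<notin> set (z # p)"
  shows "is_path G v (v # z # p) w"
  using assms by (auto simp: is_path_def nth_Cons split: nat.splits)

lemma path_of_rtrancl:
  assumes "simple_graph G" "(u, v) \<in> {(x, y). {x, y} \<in> uedges G}\<^sup>*" "u \<in> uverts G"
  shows "\<exists>p. is_path G u p v"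
  using assms(2)
proof induction
  case base
  have "is_path G u [u] u" using assms(3) by (simp add: is_path_def)
  then show ?case ..
next
  case (step v w)
  then obtain p where p: "is_path G u p v" and e: "{v, w} \<in> uedges G" by auto
  show ?case
  proof (cases "w \<in> set p")
    case True
    then show ?thesis using is_path_take[OF p] by (auto simp: in_set_conv_nth)
  next
    case False
    moreover have "w \<in> uverts G" using e assms(1) by (auto simp: simple_graph_def)
    ultimately show ?thesis using is_path_snoc[OF p e] by blast
  qed
qed

lemma ex_shortest_path:
  assumes "simple_graph G" "connected_graph G" "u \<in> uverts G" "v \<in> uverts G"
  shows "\<exists>p. is_path G u p v \<and> length p = Suc (vdist G u v)"
proof -
  obtain p where "is_path G u p v"
    using path_of_rtrancl[OF assms(1) _ assms(3)] assms(2-4) unfolding connected_graph_def by blast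
  then have "is_path G u p v \<and> length p = Suc (length p - 1)" by (auto simp: is_path_def)
  then have "\<exists>k p. is_path G u p v \<and> length p = Suc k" by blast
  then show ?thesis unfolding vdist_def by (rule LeastI_ex)
qed

lemma vdist_less_length:
  assumes "is_path G u p v"
  shows "vdist G u v < length p"
proof -
  have "length p = Suc (length p - 1)" using assms by (auto simp: is_path_def)
  then have "vdist G u v \<le> length p - 1"
    unfolding vdist_def using assms by (intro Least_le) blast
  then show ?thesis using \<open>length p = Suc (length p - 1)\<close> by linarith
qed

lemma vdist_eq_0_iff:
  assumes "simple_graph G" "connected_graph G" "u \<in> uverts G" "v \<in> uverts G"
  shows "vdist G u v = 0 \<longleftrightarrow> u = v"
proof
  assume "vdist G u v = 0"
  then obtain p where "is_path G u p v" "length p = Suc 0"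
    using ex_shortest_path[OF assms] by auto
  then show "u = v" by (auto simp: is_path_def length_Suc_conv)
next
  assume "u = v"
  then have "is_path G u [u] v" using assms by (simp add: is_path_def)
  from vdist_less_length[OF this] show "vdist G u v = 0" by simp
qed

lemma vdist_le_1_iff:
  assumes "simple_graph G" "connected_graph G" "u \<in> uverts G" "v \<in> uverts G"
  shows "vdist G u v \<le> 1 \<longleftrightarrow> u = v \<or> {u, v} \<in> uedges G"
proof
  assume "vdist G u v \<le> 1"
  then consider "vdist G u v = 0" | "vdist G u v = 1" by linarith
  then show "u = v \<or> {u, v} \<in> uedges G"
  proof cases
    case 1
    then show ?thesis using vdist_eq_0_iff[OF assms] by simp
  next
    case 2
    then obtain p where "is_path G u p v" "length p = Suc (Suc 0)"
      using ex_shortest_path[OF assms] by auto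
    then show ?thesis by (auto simp: is_path_def length_Suc_conv)
  qed
next
  assume *: "u = v \<or> {u, v} \<in> uedges G"
  show "vdist G u v \<le> 1"
  proof (cases "u = v")
    case True
    then show ?thesis using vdist_eq_0_iff[OF assms] by simp
  next
    case False
    then have "is_path G u [u, v] v" using * assms by (simp add: is_path_def)
    from vdist_less_length[OF this] show ?thesis by simp
  qed
qed

lemma edge_finite_nonempty:
  assumes "simple_graph G" "e \<in> uedges G"
  shows "finite e" "e \<noteq> {}"
  using assms by (auto simp: simple_graph_def card_2_iff)

lemma edist_le_iff:
  assumes "simple_graph G" "e \<in> uedges G"
  shows "edist G e w \<le> k \<longleftrightarrow> (\<exists>x \<in> e. vdist G x w \<le> k)"
  unfolding edist_def using edge_finite_nonempty[OF assms] by (subst Min_le_iff) auto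

lemma edist_eq_0_iff:
  assumes "simple_graph G" "connected_graph G" "e \<in> uedges G" "w \<in> uverts G"
  shows "edist G e w = 0 \<longleftrightarrow> w \<in> e"
proof -
  have "e \<subseteq> uverts G" using assms by (auto simp: simple_graph_def)
  then have "edist G e w \<le> 0 \<longleftrightarrow> w \<in> e"
    unfolding edist_le_iff[OF assms(1,3)] using vdist_eq_0_iff[OF assms(1,2) _ assms(4)] by auto
  then show ?thesis by simp
qed

lemma edist_le_1_iff:
  assumes "simple_graph G" "connected_graph G" "e \<in> uedges G" "w \<in> uverts G"
  shows "edist G e w \<le> 1 \<longleftrightarrow> (\<exists>x \<in> e. x = w \<or> {x, w} \<in> uedges G)"
proof -
  have "e \<subseteq> uverts G" using assms by (auto simp: simple_graph_def)
  then show ?thesis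
    unfolding edist_le_iff[OF assms(1,3)] using vdist_le_1_iff[OF assms(1,2) _ assms(4)] by auto
qed

text \<open>A shortest path from \<open>x\<close> to \<open>w\<close> either visits \<open>v\<close>, and its tail from \<open>v\<close> on is no longer, or
  it avoids \<open>v\<close>, and \<open>v\<close> can replace \<open>x\<close> as its first vertex.\<close>

lemma vdist_le_of_dominated:
  assumes G: "simple_graph G" "connected_graph G"
    and V: "v \<in> uverts G" "x \<in> uverts G" "w \<in> uverts G"
    and dom: "\<And>z. {x, z} \<in> uedges G \<Longrightarrow> z = v \<or> {v, z} \<in> uedges G"
    and "w \<noteq> x"
  shows "vdist G v w \<le> vdist G x w"
proof -
  obtain p where p: "is_path G x p w" and len: "length p = Suc (vdist G x w)"
    using ex_shortest_path[OF G V(2,3)] by blast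
  show ?thesis
  proof (cases "v \<in> set p")
    case True
    then obtain i where i: "i < length p" "p ! i = v" by (auto simp: in_set_conv_nth)
    have "vdist G v w < length (drop i p)"
      using vdist_less_length[OF is_path_drop[OF p i(1)]] i(2) by simp
    then show ?thesis using len by simp
  next
    case False
    obtain q where q: "p = x # q" using p by (cases p) (auto simp: is_path_def)
    obtain z r where zr: "q = z # r" using p q \<open>w \<noteq> x\<close> by (cases q) (auto simp: is_path_def)
    have "Suc 0 < length p" using q zr by simp
    then have "{p ! 0, p ! Suc 0} \<in> uedges G" using p unfolding is_path_def by blast
    then have "{x, z} \<in> uedges G" using q zr by simp
    then have "{v, z} \<in> uedges G" using dom[of z] False q zr by auto
    then have "is_path G v (v # z # r) w"
      using is_path_change_head[of G x z r w v] p False V(1) q zr by simp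
    from vdist_less_length[OF this] show ?thesis using len q zr by simp
  qed
qed

section \<open>Silicates\<close>

lemma edge_silicateE:
  assumes "s \<in> uedges (silicate G)"
  obtains e where "e \<in> uedges G" "s \<subseteq> tetrahedron e" "card s = 2"
  using assms by (auto simp: silicate_def)

lemma simple_graph_silicate:
  assumes "simple_graph G"
  shows "simple_graph (silicate G)"
proof -
  have "tetrahedron e \<subseteq> uverts (silicate G)" if "e \<in> uedges G" for e
  proof -
    have "e \<subseteq> uverts G" using assms that by (auto simp: simple_graph_def)
    then show ?thesis using that by (auto simp: silicate_def tetrahedron_def)
  qed
  then show ?thesis
    unfolding simple_graph_def by (metis edge_silicateE subset_trans)
qed

lemma edge_silicateI:
  "e \<in> uedges G \<Longrightarrow> x \<in> tetrahedron e \<Longrightarrow> y \<in> tetrahedron e \<Longrightarrow> x \<noteq> y \<Longrightarrow>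
     {x, y} \<in> uedges (silicate G)"
  by (auto simp: silicate_def)

lemma Apex_mem_tetrahedron_iff [simp]: "Apex f b \<in> tetrahedron e \<longleftrightarrow> f = e"
  by (cases b) (auto simp: tetrahedron_def)

lemma Base_mem_tetrahedron_iff [simp]: "Base v \<in> tetrahedron e \<longleftrightarrow> v \<in> e"
  by (auto simp: tetrahedron_def)

lemma neighbours_of_apex:
  assumes "e \<in> uedges G"
  shows "{x, Apex e b} \<in> uedges (silicate G) \<longleftrightarrow> x \<in> tetrahedron e \<and> x \<noteq> Apex e b"
proof
  assume a: "{x, Apex e b} \<in> uedges (silicate G)"
  then obtain f where f: "{x, Apex e b} \<subseteq> tetrahedron f" "card {x, Apex e b} = 2"
    by (rule edge_silicateE)
  then have "f = e" by simp
  then show "x \<in> tetrahedron e \<and> x \<noteq> Apex e b" using f by auto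
qed (use assms in \<open>auto intro: edge_silicateI\<close>)

lemma connected_silicate:
  assumes G: "simple_graph G" "connected_graph G"
  shows "connected_graph (silicate G)"
proof -
  let ?R = "{(x, y). {x, y} \<in> uedges G}" and ?R' = "{(x, y). {x, y} \<in> uedges (silicate G)}"
  have base: "(Base u, Base v) \<in> ?R'\<^sup>*" if "(u, v) \<in> ?R\<^sup>*" for u v
    using that
  proof induction
    case (step v w)
    then have e: "{v, w} \<in> uedges G" by simp
    then have "v \<noteq> w" using G(1) by (auto simp: simple_graph_def)
    then have "(Base v, Base w) \<in> ?R'" using edge_silicateI[OF e, of "Base v" "Base w"] by simp
    then show ?case using step.IH by (rule rtrancl_into_rtrancl[rotated])
  qed simp
  have "sym (?R'\<^sup>*)" by (intro sym_rtrancl) (auto simp: sym_def insert_commute)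
  then have sym: "(y, x) \<in> ?R'\<^sup>*" if "(x, y) \<in> ?R'\<^sup>*" for x y
    using that by (rule symD)
  \<comment> \<open>An apex reduces to a base vertex of its own tetrahedron.\<close>
  have near: "\<exists>u \<in> uverts G. (x, Base u) \<in> ?R'\<^sup>*" if x: "x \<in> uverts (silicate G)" for x
  proof (cases x)
    case (Base u)
    then show ?thesis using x by (auto simp: silicate_def)
  next
    case (Apex e b)
    then have e: "e \<in> uedges G" using x by (auto simp: silicate_def)
    then obtain u where u: "u \<in> e" using edge_finite_nonempty[OF G(1)] by blast
    then have "u \<in> uverts G" using e G(1) by (auto simp: simple_graph_def)
    moreover have "(x, Base u) \<in> ?R'" using edge_silicateI[OF e, of x "Base u"] u Apex by simp
    ultimately show ?thesis by blast
  qed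
  show ?thesis unfolding connected_graph_def
  proof (intro ballI)
    fix x y assume "x \<in> uverts (silicate G)" "y \<in> uverts (silicate G)"
    then obtain u v where uv: "u \<in> uverts G" "v \<in> uverts G"
      "(x, Base u) \<in> ?R'\<^sup>*" "(y, Base v) \<in> ?R'\<^sup>*" using near by meson
    have "(u, v) \<in> ?R\<^sup>*" using G(2) uv(1,2) by (auto simp: connected_graph_def)
    then show "(x, y) \<in> ?R'\<^sup>*" using base uv(3) sym[OF uv(4)] by (meson rtrancl_trans)
  qed
qed

text \<open>The base vertex \<open>v\<close> dominates the apex: it is equal or adjacent to every neighbour of the
  apex, so the minimum over the two ends is attained at \<open>v\<close>.\<close>

lemma edist_apex_edge:
  assumes G: "simple_graph G" "connected_graph G"
    and e: "e \<in> uedges G" "v \<in> e"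
    and w: "w \<in> uverts (silicate G)" "w \<noteq> Apex e b"
  shows "edist (silicate G) {Base v, Apex e b} w = vdist (silicate G) (Base v) w"
proof -
  have "vdist (silicate G) (Base v) w \<le> vdist (silicate G) (Apex e b) w"
  proof (rule vdist_le_of_dominated[OF simple_graph_silicate[OF G(1)] connected_silicate[OF G]])
    show "Base v \<in> uverts (silicate G)" "Apex e b \<in> uverts (silicate G)"
      using e G(1) by (auto simp: silicate_def simple_graph_def)
    show "z = Base v \<or> {Base v, z} \<in> uedges (silicate G)"
      if "{Apex e b, z} \<in> uedges (silicate G)" for z
      using that edge_silicateI[OF e(1), of "Base v" z] neighbours_of_apex[OF e(1), of z b] e(2)
      by (auto simp: insert_commute)
  qed (use w in auto)
  then show ?thesis by (simp add: edist_def)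
qed

text \<open>From any vertex other than the two apices, both edges are exactly as far away as their common
  base vertex.\<close>

lemma apex_in_edge_resolving:
  assumes G: "simple_graph G" "connected_graph G"
    and S: "edge_resolving (silicate G) S"
    and e: "e \<in> uedges G" "v \<in> e" and f: "f \<in> uedges G" "v \<in> f"
    and ne: "Apex e b \<noteq> Apex f c"
  shows "Apex e b \<in> S \<or> Apex f c \<in> S"
proof (rule ccontr)
  assume no: "\<not> ?thesis"
  have vx: "{Base v, Apex e b} \<in> uedges (silicate G)" "{Base v, Apex f c} \<in> uedges (silicate G)"
    using e f by (simp_all add: neighbours_of_apex)
  have "{Base v, Apex e b} \<noteq> {Base v, Apex f c}" using ne by (auto simp: doubleton_eq_iff)
  then obtain w where w: "w \<in> S"
    "edist (silicate G) {Base v, Apex e b} w \<noteq> edist (silicate G) {Base v, Apex f c} w"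
    using S[unfolded edge_resolving_def, THEN conjunct2, rule_format, OF vx] by blast
  have "w \<in> uverts (silicate G)" using w(1) S by (auto simp: edge_resolving_def)
  then show False
    using w no edist_apex_edge[OF G e, of w b] edist_apex_edge[OF G f, of w c] by metis
qed

text \<open>The closed neighbourhood of an apex is its tetrahedron.\<close>

lemma meets_tetrahedron_iff:
  assumes G: "simple_graph G" "connected_graph G" and e: "e \<in> uedges G"
    and s: "s \<in> uedges (silicate G)"
  shows "edist (silicate G) s (Apex e b) \<le> 1 \<longleftrightarrow> s \<inter> tetrahedron e \<noteq> {}"
proof -
  have "Apex e b \<in> uverts (silicate G)" using e by (auto simp: silicate_def)
  then show ?thesis
    using edist_le_1_iff[OF simple_graph_silicate[OF G(1)] connected_silicate[OF G] s]
      neighbours_of_apex[OF e, of _ b]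
    by auto
qed

section \<open>The cycle\<close>

definition cycle_edge :: "nat \<Rightarrow> nat \<Rightarrow> nat set" where
  "cycle_edge n i = {i, Suc i mod n}"

lemma uedges_cycle: "uedges (cycle_graph n) = cycle_edge n ` {..<n}"
  by (auto simp: cycle_graph_def cycle_edge_def)

lemma cycle_edge_eq_iff:
  "n \<ge> 3 \<Longrightarrow> i < n \<Longrightarrow> j < n \<Longrightarrow> cycle_edge n i = cycle_edge n j \<longleftrightarrow> i = j"
  using inj_on_cycle_edge[of n] by (auto simp: inj_on_def cycle_edge_def)

lemma connected_cycle: "connected_graph (cycle_graph n)"
proof -
  let ?R = "{(x, y). {x, y} \<in> uedges (cycle_graph n)}"
  have step: "(i, Suc i) \<in> ?R" if "Suc i < n" for i
    using that by (auto simp: cycle_graph_def intro!: exI[of _ i])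
  have from_0: "(0, i) \<in> ?R\<^sup>*" if "i < n" for i
    using that
  proof (induction i)
    case (Suc i)
    then show ?case using step[of i] by (meson Suc_lessD rtrancl_into_rtrancl)
  qed simp
  have "sym (?R\<^sup>*)" by (intro sym_rtrancl) (auto simp: sym_def insert_commute)
  then show ?thesis
    unfolding connected_graph_def using from_0
    by (auto simp: cycle_graph_def) (meson rtrancl_trans symD lessThan_iff)
qed

text \<open>On a cycle of length at least 4, one, two or three steps do not lead back to the start. Three
  steps matter because tetrahedra two steps apart must be disjoint.\<close>

lemma cycle_succ:
  assumes "n \<ge> 4" "i < n"
  shows "Suc i mod n < n" "Suc i mod n \<noteq> i" "Suc (Suc i mod n) mod n \<noteq> i"
    "Suc (Suc (Suc i mod n) mod n) mod n \<noteq> i"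
  using assms by (auto simp: mod_Suc)

lemma cycle_succ_inj: "i < n \<Longrightarrow> j < n \<Longrightarrow> Suc i mod n = Suc j mod n \<Longrightarrow> i = j"
  by (auto simp: mod_Suc split: if_splits)

lemma cycle_pred:
  assumes "i < n"
  obtains r where "r < n" "Suc r mod n = i"
proof (cases i)
  case 0
  then show ?thesis using assms that[of "n - 1"] by simp
next
  case (Suc r)
  then show ?thesis using assms that[of r] by simp
qed

section \<open>An optimal edge resolving set\<close>

definition cycle_tetrahedron :: "nat \<Rightarrow> nat \<Rightarrow> nat silicate_vertex set" where
  "cycle_tetrahedron n i = tetrahedron (cycle_edge n i)"

lemma mem_cycle_tetrahedron:
  "x \<in> cycle_tetrahedron n i \<longleftrightarrow>
     x = Base i \<or> x = Base (Suc i mod n) \<or>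
     x = Apex (cycle_edge n i) False \<or> x = Apex (cycle_edge n i) True"
  by (auto simp: cycle_tetrahedron_def tetrahedron_def cycle_edge_def)

lemma two_subset_eq:
  assumes "s \<subseteq> {a, b, c, d}" "t \<subseteq> {a, b, c, d}" "card s = 2" "card t = 2"
    and "a \<in> s \<longleftrightarrow> a \<in> t" "b \<in> s \<longleftrightarrow> b \<in> t" "c \<in> s \<longleftrightarrow> c \<in> t"
  shows "s = t"
proof -
  have fin: "finite s" "finite t" using assms(1,2) finite_subset by auto
  have "s \<subseteq> t \<or> t \<subseteq> s" using assms(1,2,5-7) by blast
  then show ?thesis using assms(3,4) fin by (metis card_subset_eq)
qed

lemma mem_iff_meets:
  assumes "X \<inter> Y = {x}" "u \<subseteq> X"
  shows "x \<in> u \<longleftrightarrow> u \<inter> Y \<noteq> {}"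
proof -
  have "u \<inter> Y = u \<inter> {x}" using assms by blast
  then show ?thesis by simp
qed

lemma cycle_tetrahedra_consecutive:
  assumes "n \<ge> 4" "i < n"
  shows "cycle_tetrahedron n i \<inter> cycle_tetrahedron n (Suc i mod n) = {Base (Suc i mod n)}"
  using assms cycle_succ[OF assms] cycle_succ(1,2)[OF assms(1) cycle_succ(1)[OF assms]]
    cycle_edge_eq_iff[of n i "Suc i mod n"]
  by (auto simp: mem_cycle_tetrahedron)

lemma cycle_tetrahedra_at_distance_two:
  assumes "n \<ge> 4" "i < n"
  shows "cycle_tetrahedron n i \<inter> cycle_tetrahedron n (Suc (Suc i mod n) mod n) = {}"
proof -
  obtain j k l where j: "j = Suc i mod n" and k: "k = Suc j mod n" and l: "l = Suc k mod n"
    by blast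
  have "j < n" using cycle_succ(1)[OF assms] j by simp
  then have "k < n" using cycle_succ(1)[OF assms(1)] k by simp
  have "i \<noteq> k" "i \<noteq> l"
    using cycle_succ(3,4)[OF assms] unfolding j[symmetric] k[symmetric] l[symmetric] by blast+
  moreover have "j \<noteq> k" "j \<noteq> l"
    using cycle_succ(2,3)[OF assms(1) \<open>j < n\<close>] unfolding k[symmetric] l[symmetric] by blast+
  moreover have "cycle_edge n i = {i, j}" "cycle_edge n k = {k, l}"
    by (simp_all add: cycle_edge_def j l)
  ultimately have "cycle_tetrahedron n i \<inter> cycle_tetrahedron n k = {}"
    by (auto simp: cycle_tetrahedron_def tetrahedron_def doubleton_eq_iff)
  then show ?thesis unfolding j k .
qed

lemma cycle_tetrahedra_meet:
  assumes "n \<ge> 4" "i < n" "j < n" "i \<noteq> j"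
    and "cycle_tetrahedron n i \<inter> cycle_tetrahedron n j \<noteq> {}"
  shows "j = Suc i mod n \<or> i = Suc j mod n"
  using assms cycle_edge_eq_iff[of n i j] cycle_succ_inj[of i n j]
  by (auto simp: mem_cycle_tetrahedron)

text \<open>If the two edges lie in different tetrahedra, the chosen apices exclude all candidates one by
  one: both edges must contain the common base vertex and neither may contain a chosen apex of
  its own tetrahedron. In the tetrahedron both of whose apices are chosen, only the edge of the
  cycle remains, and this one meets a further tetrahedron that the other edge does not reach.\<close>

lemma edges_in_consecutive_tetrahedra_separated:
  assumes n: "even n" "n \<ge> 4" and i: "i < n"
    and s: "s \<subseteq> cycle_tetrahedron n i" "card s = 2"
    and t: "t \<subseteq> cycle_tetrahedron n (Suc i mod n)" "card t = 2"
    and F: "\<And>k. k < n \<Longrightarrow> Apex (cycle_edge n k) False \<in> s \<longleftrightarrow> Apex (cycle_edge n k) False \<in> t"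
    and T: "\<And>k. k < n \<Longrightarrow> even k \<Longrightarrow>
              Apex (cycle_edge n k) True \<in> s \<longleftrightarrow> Apex (cycle_edge n k) True \<in> t"
    and M: "\<And>k. k < n \<Longrightarrow>
              s \<inter> cycle_tetrahedron n k \<noteq> {} \<longleftrightarrow> t \<inter> cycle_tetrahedron n k \<noteq> {}"
  shows False
proof -
  let ?j = "Suc i mod n"
  note j = cycle_succ(1)[OF n(2) i]
  have ne: "s \<noteq> {}" "t \<noteq> {}" using s(2) t(2) by auto
  have "cycle_edge n i \<noteq> cycle_edge n ?j"
    using cycle_edge_eq_iff[of n i ?j] n(2) i cycle_succ[OF n(2) i] by simp
  then have foreign: "Apex (cycle_edge n i) b \<notin> t" "Apex (cycle_edge n ?j) b \<notin> s" for b
    using s(1) t(1) by (auto simp: cycle_tetrahedron_def)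
  \<comment> \<open>Parity alternates even across the step from \<open>n - 1\<close> to \<open>0\<close>, because \<open>n\<close> is even.\<close>
  consider "even i" | "even ?j"
    using n(1) i by (cases "Suc i = n") auto
  then show False
  proof cases
    case 1
    then have "Apex (cycle_edge n i) b \<notin> s" for b
      using foreign(1)[of b] F[OF i] T[OF i] by (cases b) auto
    then have "s \<subseteq> {Base i, Base ?j}" using s(1) by (auto simp: subset_iff mem_cycle_tetrahedron)
    then have "Base i \<in> s"
      using s(2) card_mono[of "{Base ?j}" s] by (cases "Base i \<in> s") auto
    obtain r where r: "r < n" "Suc r mod n = i" using cycle_pred[OF i] .
    have "Base i \<in> cycle_tetrahedron n r" using r by (simp add: mem_cycle_tetrahedron)
    then have "t \<inter> cycle_tetrahedron n r \<noteq> {}" using M[OF r(1)] \<open>Base i \<in> s\<close> by blast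
    then show False
      using cycle_tetrahedra_at_distance_two[OF n(2) r(1)] t(1) r(2) by blast
  next
    case 2
    let ?k = "Suc ?j mod n"
    have "Apex (cycle_edge n ?j) b \<notin> t" for b
      using foreign(2)[of b] F[OF j] T[OF j] 2 by (cases b) auto
    then have "t \<subseteq> {Base ?j, Base ?k}" using t(1) by (auto simp: subset_iff mem_cycle_tetrahedron)
    then have "Base ?k \<in> t"
      using t(2) card_mono[of "{Base ?j}" t] by (cases "Base ?k \<in> t") auto
    moreover have "Base ?k \<in> cycle_tetrahedron n ?k" by (simp add: mem_cycle_tetrahedron)
    ultimately have "s \<inter> cycle_tetrahedron n ?k \<noteq> {}"
      using M[OF cycle_succ(1)[OF n(2) j]] by blast
    then show False
      using cycle_tetrahedra_at_distance_two[OF n(2) i] s(1) by blast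
  qed
qed

text \<open>Within one tetrahedron, an edge is determined by its membership bits at three of the four
  vertices: the chosen apex and the two base vertices. Edges of different tetrahedra can agree
  on meeting both tetrahedra only if these are consecutive, the case excluded above.\<close>

lemma edge_determined_by_tetrahedra:
  assumes n: "even n" "n \<ge> 4" and i: "i < n" and j: "j < n"
    and s: "s \<subseteq> cycle_tetrahedron n i" "card s = 2"
    and t: "t \<subseteq> cycle_tetrahedron n j" "card t = 2"
    and F: "\<And>k. k < n \<Longrightarrow> Apex (cycle_edge n k) False \<in> s \<longleftrightarrow> Apex (cycle_edge n k) False \<in> t"
    and T: "\<And>k. k < n \<Longrightarrow> even k \<Longrightarrow>
              Apex (cycle_edge n k) True \<in> s \<longleftrightarrow> Apex (cycle_edge n k) True \<in> t"
    and M: "\<And>k. k < n \<Longrightarrow>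
              s \<inter> cycle_tetrahedron n k \<noteq> {} \<longleftrightarrow> t \<inter> cycle_tetrahedron n k \<noteq> {}"
  shows "s = t"
proof (cases "i = j")
  case True
  obtain r where r: "r < n" "Suc r mod n = i" using cycle_pred[OF i] .
  let ?k = "Suc i mod n"
  \<comment> \<open>The two neighbouring tetrahedra each detect one base vertex.\<close>
  have t': "t \<subseteq> cycle_tetrahedron n i" using t(1) True by simp
  have "cycle_tetrahedron n i \<inter> cycle_tetrahedron n r = {Base i}"
    using cycle_tetrahedra_consecutive[OF n(2) r(1)] r(2) by (simp add: Int_commute)
  from mem_iff_meets[OF this s(1)] mem_iff_meets[OF this t'] M[OF r(1)]
  have B1: "Base i \<in> s \<longleftrightarrow> Base i \<in> t" by (simp only:)
  have "cycle_tetrahedron n i \<inter> cycle_tetrahedron n ?k = {Base ?k}"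
    by (rule cycle_tetrahedra_consecutive[OF n(2) i])
  from mem_iff_meets[OF this s(1)] mem_iff_meets[OF this t'] M[OF cycle_succ(1)[OF n(2) i]]
  have B2: "Base ?k \<in> s \<longleftrightarrow> Base ?k \<in> t" by (simp only:)
  have "cycle_tetrahedron n i =
      {Base i, Base ?k, Apex (cycle_edge n i) False, Apex (cycle_edge n i) True}"
    by (auto simp: mem_cycle_tetrahedron)
  then show ?thesis using two_subset_eq[OF _ _ s(2) t(2) B1 B2 F[OF i]] s(1) t' by (simp only:)
next
  case False
  have "s \<noteq> {}" using s(2) by auto
  then have "s \<inter> cycle_tetrahedron n i \<noteq> {}" using s(1) by blast
  then have "cycle_tetrahedron n i \<inter> cycle_tetrahedron n j \<noteq> {}" using M[OF i] t(1) by blast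
  then consider "j = Suc i mod n" | "i = Suc j mod n"
    using cycle_tetrahedra_meet[OF n(2) i j False] by blast
  then show ?thesis
  proof cases
    case 1
    then show ?thesis
      using edges_in_consecutive_tetrahedra_separated[OF n i s _ t(2) F T M] t(1) by blast
  next
    case 2
    then show ?thesis
      using edges_in_consecutive_tetrahedra_separated[OF n j t _ s(2) F[symmetric] T[symmetric]
          M[symmetric]] s(1)
      by blast
  qed
qed

definition resolving_apices :: "nat \<Rightarrow> nat silicate_vertex set" where
  "resolving_apices n =
     (\<lambda>i. Apex (cycle_edge n i) False) ` {..<n} \<union>
     (\<lambda>k. Apex (cycle_edge n (2 * k)) True) ` {..<n div 2}"

lemma card_resolving_apices:
  assumes "even n" "n \<ge> 4"
  shows "card (resolving_apices n) = 3 * n div 2"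
proof -
  have "inj_on (\<lambda>i. Apex (cycle_edge n i) False) {..<n}"
    using assms by (auto simp: inj_on_def cycle_edge_eq_iff)
  moreover have "inj_on (\<lambda>k. Apex (cycle_edge n (2 * k)) True) {..<n div 2}"
    using assms by (auto simp: inj_on_def cycle_edge_eq_iff)
  ultimately have "card (resolving_apices n) = n + n div 2"
    unfolding resolving_apices_def by (subst card_Un_disjoint) (auto simp: card_image)
  then show ?thesis using assms(1) by auto
qed

lemma edge_resolving_resolving_apices:
  assumes n: "even n" "n \<ge> 4"
  shows "edge_resolving (cyclic_silicate n) (resolving_apices n)"
proof -
  let ?G = "cycle_graph n" and ?S = "resolving_apices n"
  have G: "simple_graph ?G" "connected_graph ?G"
    using simple_graph_cycle connected_cycle n(2) by auto
  have E: "cycle_edge n i \<in> uedges ?G" if "i < n" for i using that by (simp add: uedges_cycle)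
  have V: "Apex (cycle_edge n i) b \<in> uverts (silicate ?G)" if "i < n" for i b
    using E[OF that] by (auto simp: silicate_def)
  have SF: "Apex (cycle_edge n i) False \<in> ?S" if "i < n" for i
    using that by (simp add: resolving_apices_def)
  have ST: "Apex (cycle_edge n i) True \<in> ?S" if "i < n" "even i" for i
  proof -
    have "i = 2 * (i div 2)" "i div 2 < n div 2" using that n(1) by (auto elim!: evenE)
    then show ?thesis unfolding resolving_apices_def by (metis UnI2 imageI lessThan_iff)
  qed
  have "?S \<subseteq> uverts (silicate ?G)" using V by (auto simp: resolving_apices_def)
  moreover have "\<exists>w \<in> ?S. edist (silicate ?G) s w \<noteq> edist (silicate ?G) t w"
    if st: "s \<in> uedges (silicate ?G)" "t \<in> uedges (silicate ?G)" "s \<noteq> t" for s t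
  proof (rule ccontr)
    assume "\<not> ?thesis"
    then have eq: "edist (silicate ?G) s w = edist (silicate ?G) t w" if "w \<in> ?S" for w
      using that by blast
    obtain i where i: "i < n" "s \<subseteq> cycle_tetrahedron n i" "card s = 2"
      using edge_silicateE[OF st(1)] by (auto simp: uedges_cycle cycle_tetrahedron_def)
    obtain j where j: "j < n" "t \<subseteq> cycle_tetrahedron n j" "card t = 2"
      using edge_silicateE[OF st(2)] by (auto simp: uedges_cycle cycle_tetrahedron_def)
    note zero = edist_eq_0_iff[OF simple_graph_silicate[OF G(1)] connected_silicate[OF G]]
    have mem: "Apex (cycle_edge n k) b \<in> s \<longleftrightarrow> Apex (cycle_edge n k) b \<in> t"
      if "k < n" "Apex (cycle_edge n k) b \<in> ?S" for k b
      using zero[OF st(1) V[OF that(1), of b]] zero[OF st(2) V[OF that(1), of b]] eq[OF that(2)] by simp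
    have "s = t"
    proof (rule edge_determined_by_tetrahedra[OF n i(1) j(1) i(2,3) j(2,3)])
      fix k assume k: "k < n"
      show "s \<inter> cycle_tetrahedron n k \<noteq> {} \<longleftrightarrow> t \<inter> cycle_tetrahedron n k \<noteq> {}"
        using meets_tetrahedron_iff[OF G E[OF k] st(1), of False]
          meets_tetrahedron_iff[OF G E[OF k] st(2), of False] eq[OF SF[OF k]]
        unfolding cycle_tetrahedron_def by simp
    qed (use mem SF ST in auto)
    with st(3) show False ..
  qed
  ultimately show ?thesis unfolding edge_resolving_def cyclic_silicate_def by blast
qed

section \<open>The edge metric dimension\<close>

text \<open>The base vertex in the middle of this quadruple is \<open>Suc i\<close>, the common end of the edges with
  indices \<open>i\<close> and \<open>Suc i\<close>; in this way even \<open>i\<close> below \<open>n\<close> yield disjoint quadruples without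
  wrapping around.\<close>

definition apices_around :: "nat \<Rightarrow> nat \<Rightarrow> nat silicate_vertex set" where
  "apices_around n i = case_prod Apex ` ({cycle_edge n i, cycle_edge n (Suc i)} \<times> UNIV)"

lemma three_apices_around:
  assumes "n \<ge> 4" "Suc i < n" and S: "edge_resolving (cyclic_silicate n) S"
  shows "card (apices_around n i \<inter> S) \<ge> 3"
proof -
  let ?Q = "apices_around n i"
  have "cycle_edge n i \<noteq> cycle_edge n (Suc i)" using cycle_edge_eq_iff[of n i "Suc i"] assms by simp
  moreover have "inj_on (case_prod Apex) X" for X :: "(nat set \<times> bool) set"
    by (auto simp: inj_on_def)
  ultimately have "card ?Q = 4"
    by (simp add: apices_around_def card_image card_cartesian_product)
  have fin: "finite ?Q" by (simp add: apices_around_def)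
  have "x = y" if xy: "x \<in> ?Q - S" "y \<in> ?Q - S" for x y
  proof (rule ccontr)
    assume "x \<noteq> y"
    obtain e b f c where "x = Apex e b" "y = Apex f c"
      "e \<in> {cycle_edge n i, cycle_edge n (Suc i)}" "f \<in> {cycle_edge n i, cycle_edge n (Suc i)}"
      using xy unfolding apices_around_def by auto
    moreover have "Suc i \<in> cycle_edge n i" "Suc i \<in> cycle_edge n (Suc i)"
      using assms(2) by (auto simp: cycle_edge_def)
    moreover have "cycle_edge n i \<in> uedges (cycle_graph n)"
      "cycle_edge n (Suc i) \<in> uedges (cycle_graph n)"
      using assms(2) by (auto simp: uedges_cycle)
    ultimately have "x \<in> S \<or> y \<in> S"
      using apex_in_edge_resolving[OF simple_graph_cycle connected_cycle
          S[unfolded cyclic_silicate_def], of e "Suc i" f b c] assms(1) \<open>x \<noteq> y\<close>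
      by auto
    then show False using xy by blast
  qed
  then have "card (?Q - S) \<le> 1" using fin by (simp add: card_le_Suc0_iff_eq)
  moreover have "card ?Q = card (?Q \<inter> S) + card (?Q - S)"
    using card_Un_disjoint[of "?Q \<inter> S" "?Q - S"] fin by (simp add: Int_Diff_Un Int_Diff_disjoint)
  ultimately show ?thesis using \<open>card ?Q = 4\<close> by linarith
qed

lemma edge_resolving_card_ge:
  assumes n: "even n" "n \<ge> 4" and S: "edge_resolving (cyclic_silicate n) S" "finite S"
  shows "3 * n div 2 \<le> card S"
proof -
  let ?Q = "\<lambda>k. apices_around n (2 * k) \<inter> S"
  have small: "Suc (2 * k) < n" if "k < n div 2" for k using that n(1) by (auto elim!: evenE)
  have disj: "?Q k \<inter> ?Q l = {}" if "k < n div 2" "l < n div 2" "k \<noteq> l" for k l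
  proof -
    have "2 * k \<noteq> Suc (2 * l)" "2 * l \<noteq> Suc (2 * k)" by presburger+
    then show ?thesis
      using that small[of k] small[of l] n(2) by (auto simp: apices_around_def cycle_edge_eq_iff)
  qed
  have "3 * n div 2 = (\<Sum>k<n div 2. 3)" using n(1) by (auto elim!: evenE)
  also have "\<dots> \<le> (\<Sum>k<n div 2. card (?Q k))"
    by (rule sum_mono) (use three_apices_around[OF n(2) small S(1)] in auto)
  also have "\<dots> = card (\<Union>k<n div 2. ?Q k)"
    using S(2) disj by (intro card_UN_disjoint[symmetric]) auto
  also have "\<dots> \<le> card S" using S(2) by (intro card_mono) auto
  finally show ?thesis .
qed

theorem theorem3:
  fixes n :: nat
  assumes "even n" and "n \<ge> 4"
  shows "edge_metric_dim (cyclic_silicate n) = 3 * n div 2"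
  unfolding edge_metric_dim_def
proof (rule Least_equality)
  have "finite (resolving_apices n)" by (simp add: resolving_apices_def)
  then show "\<exists>S. edge_resolving (cyclic_silicate n) S \<and> finite S \<and> card S = 3 * n div 2"
    using edge_resolving_resolving_apices[OF assms] card_resolving_apices[OF assms] by blast
next
  fix k assume "\<exists>S. edge_resolving (cyclic_silicate n) S \<and> finite S \<and> card S = k"
  then show "3 * n div 2 \<le> k" using edge_resolving_card_ge[OF assms] by blast
qed

end
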